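(* There exists a monotonically decreasing Bergman weight $w$ on $[0,1)$ and an $\varepsilon>0$ such that, for $f(z)=e^z$, the inequality $$\|f_r\|_{A^{2q}(w)}\leq \|f\|_{A^2(w)},\qquad r=\frac{1}{\sqrt{q}},$$ does not hold for $q=2$ and does not hold for any $q\in(1,1+\varepsilon)$.
   Context: $\mathbb{D}$ is the open unit disk in $\mathbb{C}$ and $A$ denotes planar Lebesgue measure. A Bergman weight is a summable (integrable) nonnegative function $w$ on $[0,1)$. Its moments are $h_m=\int_0^1\rho^{m+1}w(\rho)\,d\rho$ for integers $m\geq 0$, and the normalization $h_0=1$ is always assumed. For $0<p<\infty$ and $f$ analytic in $\mathbb{D}$, $$\|f\|_{A^p(w)}:=\left(\frac{1}{2\pi}\int_{\mathbb{D}}|f(z)|^p\,w(|z|)\,dA(z)\right)^{1/p}.$$ For $r\in(0,1)$, $f_r(z)=f(rz)$. *)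

theory Defs
  imports "HOL-Analysis.Analysis"
begin

text \<open>A weight on \<open>[0,1)\<close> is a total function of which only the values on \<open>{0..<1}\<close> are used.\<close>

definition bergman_moment :: "(real \<Rightarrow> real) \<Rightarrow> nat \<Rightarrow> real" where
  "bergman_moment w m = (LINT \<rho>:{0..<1}|lebesgue. \<rho> ^ (m + 1) * w \<rho>)"

text \<open>The normalization \<open>h\<^sub>0 = 1\<close> is a standing assumption, so it is part of the predicate.\<close>

definition bergman_weight :: "(real \<Rightarrow> real) \<Rightarrow> bool" where
  "bergman_weight w \<longleftrightarrow>
     (\<forall>\<rho>\<in>{0..<1}. 0 \<le> w \<rho>) \<and> set_integrable lebesgue {0..<1} w \<and> bergman_moment w 0 = 1"

text \<open>
  The integral is a Bochner integral, so it is \<open>0\<close> instead of \<open>\<infinity>\<close> when \<open>|f|^p w(|z|)\<close> is not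
  integrable over the disk. This does not happen for a bounded continuous \<open>f\<close> and a Bergman weight
  \<open>w\<close>, since \<open>w(|z|)\<close> has integral \<open>2\<pi>h\<^sub>0\<close> over the disk.
\<close>

definition bergman_norm :: "real \<Rightarrow> (real \<Rightarrow> real) \<Rightarrow> (complex \<Rightarrow> complex) \<Rightarrow> real" where
  "bergman_norm p w f =
     (1 / (2 * pi) * (LINT z:ball 0 1|lebesgue. norm (f z) powr p * w (norm z))) powr (1 / p)"

definition dilation :: "real \<Rightarrow> (complex \<Rightarrow> complex) \<Rightarrow> complex \<Rightarrow> complex" where
  "dilation r f z = f (of_real r * z)"

end

theory Submission
  imports Defs
begin

text \<open>
  Put \<open>x = Re z\<close>. On the disk \<open>|exp(r z)|^(2q) = exp(2 \<surd>q x)\<close>, and by the symmetry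
  \<open>z \<mapsto> -z\<close> this may be replaced by \<open>cosh(2 \<surd>q x)\<close> under the integral. With \<open>E\<close> the
  expectation for the probability measure \<open>w(|z|) dA / 2\<pi>\<close>, the inequality to be refuted is
  \<open>E cosh(2 \<surd>q x) \<le> (E cosh(2x))^q\<close>.

  Comparing Taylor coefficients, \<open>cosh(2 \<surd>q x) \<ge> 1 + q (cosh(2x) - 1) + (q - 1) (2/3) x^4\<close>: the
  coefficient of \<open>x^(2m)\<close> grows by the factor \<open>q^m \<ge> q\<close>, and the gain over \<open>q\<close> is kept only at
  \<open>m = 2\<close> (\<open>cosh_sqrt_mult_ge\<close>). So with \<open>X = E cosh(2x) - 1\<close> and \<open>Y = (2/3) E x^4\<close> the left side is at least
  \<open>1 + q X + (q - 1) Y\<close>. For \<open>1 \<le> q \<le> 2\<close>, the exponent \<open>q - 1\<close> lies in \<open>[0,1]\<close>, and Bernoulli's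
  inequality bounds the right side by \<open>(1 + X) (1 + (q - 1) X) = 1 + q X + (q - 1) X^2\<close>
  (\<open>one_plus_powr_le\<close>). Hence any
  weight with \<open>X^2 < Y\<close> defeats the inequality for every \<open>q\<close> in \<open>(1,2]\<close> at once, so \<open>\<epsilon> = 1\<close> works.

  To make \<open>X^2\<close> much smaller than \<open>Y\<close>, concentrate almost all the mass near the origin and spread
  the small rest over the disk. This is a decreasing weight. If the spread part has mass \<open>b\<close>, then
  \<open>X\<close> and \<open>Y\<close> are both of order \<open>b\<close>, provided that the concentrated part sits in a disk of area
  at most of that order. Here mass \<open>1 - s^2\<close> is uniform on the disk of radius \<open>s\<close> and mass \<open>s^2\<close>
  is uniform on the unit disk; then \<open>X \<le> 16 s^2\<close> and \<open>Y \<ge> s^2 / 384\<close>, and \<open>s = 1/400\<close> is small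
  enough (\<open>step_mean_cosh_powr_less\<close>). Only monotonicity and the area of disks enter the estimates of these means.
\<close>

section \<open>Inequalities for the hyperbolic cosine and for powers\<close>

text \<open>
  Termwise comparison of Taylor series. The constant term is \<open>1\<close> on both sides, the terms of degree
  \<open>2m\<close> with \<open>m \<ge> 1\<close> use \<open>q^m \<ge> q\<close>, and degree 4 uses the sharper \<open>q^2 \<ge> q + (q - 1)\<close> together
  with the coefficient \<open>2^4 / 4! = 2/3\<close>.
\<close>
lemma cosh_sqrt_mult_ge:
  fixes q x :: real
  assumes "1 \<le> q"
  shows "1 + q * (cosh (2 * x) - 1) + (q - 1) * (2/3 * x ^ 4) \<le> cosh (2 * (sqrt q * x))"
proof -
  define T where "T y n = (if even n then y ^ n /\<^sub>R fact n else 0)" for y :: real and n :: nat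
  have T: "T y sums cosh y" for y
    unfolding T_def by (rule cosh_converges)
  define R where "R n = q * T (2 * x) n + (if n = 0 then 1 - q else 0)
      + (if n = 4 then (q - 1) * (2/3 * x ^ 4) else 0)" for n
  have "R sums (q * cosh (2 * x) + (1 - q) + (q - 1) * (2/3 * x ^ 4))"
    unfolding R_def
    by (intro sums_add sums_mult T sums_single[of 0 "\<lambda>_. 1 - q"]
        sums_single[of 4 "\<lambda>_. (q - 1) * (2/3 * x ^ 4)"])
  moreover have "R n \<le> T (2 * (sqrt q * x)) n" for n
  proof (cases "even n")
    case False
    then show ?thesis by (auto simp: R_def T_def)
  next
    case True
    then obtain m where n: "n = 2 * m" by (elim evenE)
    have scale: "T (2 * (sqrt q * x)) n = q ^ m * T (2 * x) n"
      using assms True by (simp add: T_def n power_mult_distrib power_mult)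
    have nonneg: "0 \<le> T (2 * x) n"
      using True by (simp add: T_def n power_mult)
    consider "m = 0" | "m = 2" | "m \<noteq> 0" "m \<noteq> 2" by blast
    then show ?thesis
    proof cases
      case 1
      then show ?thesis using n by (simp add: R_def T_def)
    next
      case 2
      have "T (2 * x) n = 2/3 * x ^ 4"
        using 2 n by (simp add: T_def power_mult_distrib fact_numeral)
      then have "T (2 * (sqrt q * x)) n - R n = (q - 1)\<^sup>2 * (2/3 * x ^ 4)"
        using scale 2 n by (simp add: R_def power2_eq_square field_simps)
      also have "\<dots> \<ge> 0"
        by simp
      finally show ?thesis by simp
    next
      case 3
      have "q ^ 1 \<le> q ^ m"
        using 3 assms by (intro power_increasing) auto
      then have "q * T (2 * x) n \<le> q ^ m * T (2 * x) n"
        using nonneg by (intro mult_right_mono) auto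
      then show ?thesis using 3 n scale by (simp add: R_def)
    qed
  qed
  ultimately have "q * cosh (2 * x) + (1 - q) + (q - 1) * (2/3 * x ^ 4) \<le> cosh (2 * (sqrt q * x))"
    by (intro sums_le[OF _ _ T])
  then show ?thesis
    by (simp add: algebra_simps)
qed

text \<open>
  In the Taylor series of \<open>cosh(2x)\<close> every term after the constant one is at most \<open>x^2\<close> times its
  value at \<open>x = 1\<close>, so the left side is at most \<open>x^2 (cosh 2 - 1)\<close>, and \<open>cosh 2 \<le> e^2 \<le> 9\<close>.
\<close>
lemma cosh_double_minus_one_le:
  fixes x :: real
  assumes "\<bar>x\<bar> \<le> 1"
  shows "cosh (2 * x) - 1 \<le> 8 * x\<^sup>2"
proof -
  define T where "T y n = (if even n then y ^ n /\<^sub>R fact n else 0)" for y :: real and n :: nat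
  have T: "T y sums cosh y" for y
    unfolding T_def by (rule cosh_converges)
  have "(\<lambda>n. x\<^sup>2 * T 2 n + (if n = 0 then 1 - x\<^sup>2 else 0)) sums (x\<^sup>2 * cosh 2 + (1 - x\<^sup>2))"
    by (intro sums_add sums_mult T sums_single[of 0 "\<lambda>_. 1 - x\<^sup>2"])
  moreover have "T (2 * x) n \<le> x\<^sup>2 * T 2 n + (if n = 0 then 1 - x\<^sup>2 else 0)" for n
  proof (cases "even n \<and> n \<noteq> 0")
    case True
    then obtain m where n: "n = 2 * m" and "m \<noteq> 0" by (auto elim: evenE)
    have "(x\<^sup>2) ^ m \<le> (x\<^sup>2) ^ 1"
      using assms \<open>m \<noteq> 0\<close> by (intro power_decreasing) (auto simp: abs_square_le_1)
    then have "x ^ n * 2 ^ n \<le> x\<^sup>2 * 2 ^ n"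
      by (intro mult_right_mono) (auto simp: n power_mult)
    then show ?thesis
      using True by (simp add: T_def power_mult_distrib field_simps)
  qed (auto simp: T_def)
  ultimately have "cosh (2 * x) \<le> x\<^sup>2 * cosh 2 + (1 - x\<^sup>2)"
    by (intro sums_le[OF _ T])
  moreover have "x\<^sup>2 * cosh 2 \<le> x\<^sup>2 * 9"
  proof (rule mult_left_mono)
    have "cosh 2 \<le> exp (2::real)"
      by (simp add: cosh_def)
    also have "\<dots> = (exp 1)\<^sup>2"
      by (simp flip: exp_double)
    also have "\<dots> \<le> 3\<^sup>2"
      by (intro power_mono exp_le) auto
    finally show "cosh 2 \<le> (9::real)" by simp
  qed simp
  ultimately show ?thesis by simp
qed

text \<open>
  Bernoulli's inequality for the exponent \<open>q - 1\<close> in \<open>[0,1]\<close>, read off from the convexity of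
  \<open>t \<mapsto> (1 + X)^t\<close> between \<open>t = 0\<close> and \<open>t = 1\<close>.
\<close>
lemma one_plus_powr_le:
  fixes X q :: real
  assumes "0 \<le> X" "1 \<le> q" "q \<le> 2"
  shows "(1 + X) powr q \<le> (1 + X) * (1 + (q - 1) * X)"
proof -
  have "exp ((1 - (q - 1)) *\<^sub>R 0 + (q - 1) *\<^sub>R ln (1 + X))
      \<le> (1 - (q - 1)) * exp 0 + (q - 1) * exp (ln (1 + X))"
    using assms by (intro convex_onD[OF exp_convex]) auto
  also have "\<dots> = 1 + (q - 1) * X"
    using assms by (simp add: algebra_simps)
  finally have "(1 + X) powr (q - 1) \<le> 1 + (q - 1) * X"
    using assms by (simp add: powr_def)
  then have "(1 + X) * (1 + X) powr (q - 1) \<le> (1 + X) * (1 + (q - 1) * X)"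
    using assms by (intro mult_left_mono) auto
  moreover have "(1 + X) * (1 + X) powr (q - 1) = (1 + X) powr q"
    using assms powr_mult_base[of "1 + X" "q - 1"] by simp
  ultimately show ?thesis by simp
qed

section \<open>Means over disks\<close>

lemma absolutely_integrable_continuous_ball:
  fixes h :: "'a::euclidean_space \<Rightarrow> 'b::euclidean_space"
  assumes "continuous_on UNIV h"
  shows "h absolutely_integrable_on ball c r"
proof -
  obtain a b where ab: "ball c r \<subseteq> cbox a b"
    using bounded_subset_cbox_symmetric[OF bounded_ball] by blast
  have "h absolutely_integrable_on cbox a b"
    by (intro absolutely_integrable_continuous continuous_on_subset[OF assms]) auto
  then show ?thesis
    by (rule set_integrable_subset) (use ab in auto)
qed

lemma integral_ball_reflect:
  fixes h :: "'a::euclidean_space \<Rightarrow> 'b::banach"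
  shows "integral (ball 0 r) (\<lambda>z. h (- z)) = integral (ball 0 r) h"
proof -
  obtain a where a: "ball (0::'a) r \<subseteq> cbox (- a) a"
    using bounded_subset_cbox_symmetric[OF bounded_ball] by blast
  \<comment> \<open>Cut the ball out of a symmetric box, which \<open>integral_reflect\<close> maps to itself.\<close>
  define H where "H z = (if z \<in> ball 0 r then h z else 0)" for z
  have "integral (ball 0 r) h = integral (cbox (- a) a) H"
    unfolding H_def integral_restrict_Int using a by (simp only: Int_absorb2)
  also have "\<dots> = integral (cbox (- a) a) (\<lambda>z. H (- z))"
    using integral_reflect[of a "- a" H] by simp
  also have "(\<lambda>z. H (- z)) = (\<lambda>z. if z \<in> ball 0 r then h (- z) else 0)"
    by (auto simp: H_def)
  also have "integral (cbox (- a) a) \<dots> = integral (ball 0 r) (\<lambda>z. h (- z))"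
    unfolding integral_restrict_Int using a by (simp only: Int_absorb2)
  finally show ?thesis ..
qed

text \<open>
  Reduces integrals against a weight with one step to unweighted integrals over nested sets; it
  serves both for the radial integral over \<open>[0,1)\<close> and for the planar one over the disk.
\<close>
lemma set_integral_mult_step:
  fixes h :: "'a \<Rightarrow> real"
  assumes "set_integrable M S h" "T \<in> sets M" "T \<subseteq> S"
  shows "(LINT x:S|M. h x * (c * indicator T x + d)) = c * (LINT x:T|M. h x) + d * (LINT x:S|M. h x)"
proof -
  have T: "set_integrable M T h"
    by (rule set_integrable_subset[OF assms])
  have "(LINT x:S|M. h x * (c * indicator T x + d))
      = (LINT x|M. c * (indicator T x *\<^sub>R h x) + d * (indicator S x *\<^sub>R h x))"
    unfolding set_lebesgue_integral_def
    using assms(3) by (intro Bochner_Integration.integral_cong refl) (auto simp: indicator_def algebra_simps)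
  also have "\<dots> = (LINT x|M. c * (indicator T x *\<^sub>R h x)) + (LINT x|M. d * (indicator S x *\<^sub>R h x))"
    using assms(1) T unfolding set_integrable_def
    by (intro Bochner_Integration.integral_add integrable_mult_right) auto
  finally show ?thesis
    by (simp add: set_lebesgue_integral_def)
qed

definition disc_mean :: "real \<Rightarrow> (complex \<Rightarrow> real) \<Rightarrow> real" where
  "disc_mean r h = integral (ball 0 r) h / (pi * r\<^sup>2)"

lemma integral_const_disc:
  assumes "0 \<le> r"
  shows "integral (ball (c::complex) r) (\<lambda>_. k) = k * (pi * r\<^sup>2)"
proof -
  have "integral (ball c r) (\<lambda>_. k * 1) = k * measure lebesgue (ball c r)"
    by (subst lmeasure_integral) (auto simp only: integral_mult_right lmeasurable_ball)
  then show ?thesis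
    using assms by (simp add: content_ball unit_ball_vol_2)
qed

lemma integrable_on_disc:
  fixes h :: "complex \<Rightarrow> real"
  shows "continuous_on UNIV h \<Longrightarrow> h integrable_on ball c r"
  by (rule set_lebesgue_integral_eq_integral(1)[OF absolutely_integrable_continuous_ball])

lemma disc_mean_const: "0 < r \<Longrightarrow> disc_mean r (\<lambda>_. k) = k"
  by (simp add: disc_mean_def integral_const_disc)

lemma disc_mean_add:
  assumes "continuous_on UNIV g" "continuous_on UNIV h"
  shows "disc_mean r (\<lambda>z. g z + h z) = disc_mean r g + disc_mean r h"
  unfolding disc_mean_def
  by (subst Henstock_Kurzweil_Integration.integral_add)
    (auto simp: assms integrable_on_disc add_divide_distrib)

lemma disc_mean_cmult: "disc_mean r (\<lambda>z. c * h z) = c * disc_mean r h"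
  by (simp add: disc_mean_def)

lemma disc_mean_mono:
  assumes "continuous_on UNIV g" "continuous_on UNIV h" "\<And>z. norm z < r \<Longrightarrow> g z \<le> h z"
  shows "disc_mean r g \<le> disc_mean r h"
  unfolding disc_mean_def
  by (intro divide_right_mono integral_le integrable_on_disc assms(1,2)) (auto simp: assms(3))

lemma disc_mean_reflect: "disc_mean r (\<lambda>z. h (- z)) = disc_mean r h"
  by (simp add: disc_mean_def integral_ball_reflect)

text \<open>
  The disk of radius \<open>1/4\<close> about \<open>3/4\<close> has area \<open>\<pi>/16\<close>, lies in the unit disk, and
  \<open>(Re z)^4 \<ge> 1/16\<close> on it. The exact mean is \<open>1/8\<close>; any positive bound would do, at the price of
  a smaller \<open>s\<close>.
\<close>
lemma disc_mean_Re_power4_ge: "1/256 \<le> disc_mean 1 (\<lambda>z. Re z ^ 4)"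
proof -
  let ?B = "ball (3/4 :: complex) (1/4)"
  have cont: "continuous_on UNIV (\<lambda>z. Re z ^ 4)"
    by (intro continuous_intros)
  have sub: "?B \<subseteq> ball 0 1"
    by (simp add: ball_subset_ball_iff dist_norm)
  have "pi / 256 = integral ?B (\<lambda>_. (1/2) ^ 4)"
    by (subst integral_const_disc) (auto simp: power_divide)
  also have "\<dots> \<le> integral ?B (\<lambda>z. Re z ^ 4)"
  proof (intro integral_le integrable_on_disc cont continuous_on_const power_mono)
    fix z :: complex assume "z \<in> ?B"
    then have "Re (3/4 - z) < 1/4"
      using complex_Re_le_cmod[of "3/4 - z"] by (simp add: dist_norm)
    then show "1/2 \<le> Re z" by simp
  qed simp
  also have "\<dots> \<le> integral (ball 0 1) (\<lambda>z. Re z ^ 4)"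
    by (intro integral_subset_le sub integrable_on_disc cont) auto
  finally show ?thesis
    by (simp add: disc_mean_def field_simps)
qed

text \<open>
  The average of \<open>exp(k Re z)\<close> and of its reflection in the origin is \<open>cosh(k Re z)\<close>. This removes
  the odd powers of \<open>Re z\<close>, which change sign on the disk and so allow no termwise comparison.
\<close>
lemma disc_mean_exp_eq_cosh:
  fixes k :: real
  shows "disc_mean r (\<lambda>z. exp (k * Re z)) = disc_mean r (\<lambda>z. cosh (k * Re z))"
proof -
  have "disc_mean r (\<lambda>z. cosh (k * Re z))
      = disc_mean r (\<lambda>z. 1/2 * exp (k * Re z) + 1/2 * exp (k * Re (- z)))"
    by (simp add: cosh_def field_simps)
  also have "\<dots> = 1/2 * disc_mean r (\<lambda>z. exp (k * Re z)) + 1/2 * disc_mean r (\<lambda>z. exp (k * Re (- z)))"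
    by (subst disc_mean_add) (auto simp only: disc_mean_cmult intro!: continuous_intros)
  also have "\<dots> = disc_mean r (\<lambda>z. exp (k * Re z))"
    using disc_mean_reflect[of r "\<lambda>z. exp (k * Re z)"] by simp
  finally show ?thesis ..
qed

lemma disc_mean_cosh_bounds:
  assumes "0 < r" "r \<le> 1"
  shows "1 \<le> disc_mean r (\<lambda>z. cosh (2 * Re z))"
    and "disc_mean r (\<lambda>z. cosh (2 * Re z)) \<le> 1 + 8 * r\<^sup>2"
proof -
  have "disc_mean r (\<lambda>_. 1) \<le> disc_mean r (\<lambda>z. cosh (2 * Re z))"
    by (intro disc_mean_mono continuous_intros cosh_real_ge_1)
  then show "1 \<le> disc_mean r (\<lambda>z. cosh (2 * Re z))"
    by (simp add: disc_mean_const assms)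
  have "disc_mean r (\<lambda>z. cosh (2 * Re z)) \<le> disc_mean r (\<lambda>_. 1 + 8 * r\<^sup>2)"
  proof (intro disc_mean_mono continuous_intros)
    fix z :: complex assume "norm z < r"
    then have z: "\<bar>Re z\<bar> \<le> r"
      using abs_Re_le_cmod[of z] by linarith
    then have "(Re z)\<^sup>2 \<le> r\<^sup>2"
      using power_mono[of "\<bar>Re z\<bar>" r 2] by simp
    then show "cosh (2 * Re z) \<le> 1 + 8 * r\<^sup>2"
      using cosh_double_minus_one_le[of "Re z"] z assms by linarith
  qed
  then show "disc_mean r (\<lambda>z. cosh (2 * Re z)) \<le> 1 + 8 * r\<^sup>2"
    by (simp add: disc_mean_const assms)
qed

lemma disc_mean_cosh_sqrt_ge:
  assumes "0 < r" "1 \<le> q"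
  shows "1 + q * (disc_mean r (\<lambda>z. cosh (2 * Re z)) - 1)
      + (q - 1) * (2/3 * disc_mean r (\<lambda>z. Re z ^ 4))
    \<le> disc_mean r (\<lambda>z. cosh (2 * (sqrt q * Re z)))"
proof -
  define c where "c = (q - 1) * (2/3)"
  have "1 + q * (disc_mean r (\<lambda>z. cosh (2 * Re z)) - 1)
      + (q - 1) * (2/3 * disc_mean r (\<lambda>z. Re z ^ 4))
    = disc_mean r (\<lambda>z. (1 - q) + (q * cosh (2 * Re z) + c * Re z ^ 4))"
    using assms
    by (simp add: disc_mean_add disc_mean_cmult disc_mean_const continuous_intros)
       (simp add: c_def algebra_simps)
  also have "\<dots> \<le> disc_mean r (\<lambda>z. cosh (2 * (sqrt q * Re z)))"
  proof (intro disc_mean_mono continuous_intros)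
    fix z :: complex
    show "(1 - q) + (q * cosh (2 * Re z) + c * Re z ^ 4) \<le> cosh (2 * (sqrt q * Re z))"
      using cosh_sqrt_mult_ge[OF assms(2), of "Re z"] by (simp add: c_def algebra_simps)
  qed
  finally show ?thesis .
qed

section \<open>A decreasing weight concentrated near the origin\<close>

text \<open>
  The mixture described by \<open>step_mean\<close>: a uniform distribution of mass \<open>1 - s^2\<close> on the disk of
  radius \<open>s\<close> and one of mass \<open>s^2\<close> on the unit disk. A uniform distribution of mass \<open>m\<close> on the
  disk of radius \<open>r\<close> corresponds to the value \<open>2 m / r^2\<close> of \<open>w\<close> there, because of the factor
  \<open>1 / 2\<pi>\<close> in the norm.
\<close>
definition step_weight :: "real \<Rightarrow> real \<Rightarrow> real" where
  "step_weight s \<rho> = 2 * (1 - s\<^sup>2) / s\<^sup>2 * indicator {..<s} \<rho> + 2 * s\<^sup>2"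

lemma antimono_step_weight:
  assumes "0 < s" "s < 1"
  shows "antimono_on A (step_weight s)"
  using assms abs_square_le_1[of s]
  by (intro monotone_onI) (auto simp: step_weight_def indicator_def)

lemma bergman_weight_step_weight:
  assumes s: "0 < s" "s < 1"
  shows "bergman_weight (step_weight s)"
proof -
  have abs_int: "h absolutely_integrable_on {0..<1}" if "continuous_on UNIV h" for h :: "real \<Rightarrow> real"
  proof (rule set_integrable_subset)
    show "h absolutely_integrable_on cbox 0 1"
      by (intro absolutely_integrable_continuous continuous_on_subset[OF that]) auto
  qed auto
  have ind: "(indicator {..<s} \<rho> :: real) = indicator {0..<s} \<rho>" if "\<rho> \<in> {0..<1}" for \<rho>
    using that by (auto simp: indicator_def)
  have half_square: "(LINT \<rho>:{0..<t}|lebesgue. \<rho>) = t\<^sup>2 / 2" if "0 < t" "t \<le> 1" for t :: real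
  proof -
    have "set_integrable lebesgue {0..<t} (\<lambda>\<rho>::real. \<rho>)"
      by (rule set_integrable_subset[OF abs_int]) (use that in auto)
    then have "(LINT \<rho>:{0..<t}|lebesgue. \<rho>) = integral {0..<t} (\<lambda>\<rho>. \<rho>)"
      by (rule set_lebesgue_integral_eq_integral)
    also have "\<dots> = integral {0..t} (\<lambda>\<rho>. \<rho>)"
      by (rule integral_spike_set; rule negligible_subset[of "{t}"]) auto
    also have "\<dots> = t\<^sup>2 / 2"
      using ident_has_integral[of 0 t] that by (auto dest: integral_unique)
    finally show ?thesis .
  qed
  have "set_integrable lebesgue {0..<1} (step_weight s)"
  proof -
    have "set_integrable lebesgue {0..<1::real} (\<lambda>_. 1 :: real)"
      by (rule abs_int) auto
    moreover have "set_integrable lebesgue {0..<1} (indicator {..<s} :: real \<Rightarrow> real)"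
    proof -
      have "set_integrable lebesgue {0..<s} (\<lambda>_. 1 :: real)"
        by (rule set_integrable_subset[OF abs_int]) (use s in auto)
      also have "?this \<longleftrightarrow> ?thesis"
        unfolding set_integrable_def
        using s by (intro Bochner_Integration.integrable_cong refl) (auto simp: indicator_def)
      finally show ?thesis .
    qed
    ultimately have "set_integrable lebesgue {0..<1}
       (\<lambda>\<rho>. 2 * (1 - s\<^sup>2) / s\<^sup>2 * indicator {..<s} \<rho> + 2 * s\<^sup>2 * 1)"
      by (intro set_integral_add set_integrable_mult_right) auto
    then show ?thesis by (simp add: step_weight_def[abs_def])
  qed
  moreover have "bergman_moment (step_weight s) 0 = 1"
  proof -
    have "bergman_moment (step_weight s) 0 
        = (LINT \<rho>:{0..<1}|lebesgue. \<rho> * (2 * (1 - s\<^sup>2) / s\<^sup>2 * indicator {0..<s} \<rho> + 2 * s\<^sup>2))"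
      unfolding bergman_moment_def
      by (rule set_lebesgue_integral_cong) (auto simp: step_weight_def ind)
    also have "\<dots> = 2 * (1 - s\<^sup>2) / s\<^sup>2 * (s\<^sup>2 / 2) + 2 * s\<^sup>2 * (1\<^sup>2 / 2)"
      by (subst set_integral_mult_step) (use s in \<open>auto simp: half_square intro!: abs_int\<close>)
    also have "\<dots> = 1"
      using s by (simp add: field_simps)
    finally show ?thesis .
  qed
  moreover have "0 \<le> step_weight s \<rho>" for \<rho>
    using s abs_square_le_1[of s] by (simp add: step_weight_def)
  ultimately show ?thesis
    by (simp add: bergman_weight_def)
qed

definition step_mean :: "real \<Rightarrow> (complex \<Rightarrow> real) \<Rightarrow> real" where
  "step_mean s h = (1 - s\<^sup>2) * disc_mean s h + s\<^sup>2 * disc_mean 1 h"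

lemma step_weight_integral:
  fixes h :: "complex \<Rightarrow> real"
  assumes s: "0 < s" "s < 1" and h: "continuous_on UNIV h"
  shows "1 / (2 * pi) * (LINT z:ball 0 1|lebesgue. h z * step_weight s (norm z))
    = step_mean s h"
proof -
  have abs_int: "h absolutely_integrable_on ball 0 r" for r
    by (rule absolutely_integrable_continuous_ball[OF h])
  have LINT: "(LINT z:ball 0 r|lebesgue. h z) = pi * r\<^sup>2 * disc_mean r h" if "0 < r" for r
    using that by (simp add: set_lebesgue_integral_eq_integral(2)[OF abs_int] disc_mean_def)
  have "(LINT z:ball 0 1|lebesgue. h z * step_weight s (norm z))
      = (LINT z:ball 0 1|lebesgue. h z * (2 * (1 - s\<^sup>2) / s\<^sup>2 * indicator (ball 0 s) z + 2 * s\<^sup>2))"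
    by (rule set_lebesgue_integral_cong) (auto simp: step_weight_def indicator_def)
  also have "\<dots> = 2 * (1 - s\<^sup>2) / s\<^sup>2 * (pi * s\<^sup>2 * disc_mean s h) + 2 * s\<^sup>2 * (pi * disc_mean 1 h)"
    by (subst set_integral_mult_step) (use s in \<open>auto simp: LINT intro!: abs_int\<close>)
  also have "\<dots> = 2 * pi * ((1 - s\<^sup>2) * disc_mean s h + s\<^sup>2 * disc_mean 1 h)"
    using s by (simp add: field_simps)
  finally show ?thesis by (simp add: step_mean_def)
qed

section \<open>Failure of the inequality\<close>

lemma bergman_norm_dilated_exp:
  assumes s: "0 < s" "s < 1" and q: "0 < q"
  shows "bergman_norm (2 * q) (step_weight s) (dilation (1 / sqrt q) exp)
    = step_mean s (\<lambda>z. cosh (2 * (sqrt q * Re z))) powr (1 / (2 * q))"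
proof -
  have "norm (dilation (1 / sqrt q) exp z) powr (2 * q) = exp (2 * sqrt q * Re z)" for z
  proof -
    have "norm (dilation (1 / sqrt q) exp z) powr (2 * q) = exp (2 * q * (Re z / sqrt q))"
      by (simp add: dilation_def powr_def)
    also have "2 * q * (Re z / sqrt q) = 2 * (q / sqrt q) * Re z"
      by simp
    finally show ?thesis
      using q by (simp add: real_div_sqrt)
  qed
  then have "bergman_norm (2 * q) (step_weight s) (dilation (1 / sqrt q) exp)
      = step_mean s (\<lambda>z. exp (2 * sqrt q * Re z)) powr (1 / (2 * q))"
    unfolding bergman_norm_def
    by (subst step_weight_integral[symmetric, OF s]) (auto intro!: continuous_intros)
  then show ?thesis
    by (simp only: step_mean_def disc_mean_exp_eq_cosh) (simp only: mult.assoc)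
qed

text \<open>
  The comparison \<open>1 + q X + (q - 1) X^2 < 1 + q X + (q - 1) Y\<close>. The bound on \<open>s\<close> is what
  \<open>X^2 \<le> (16 s^2)^2 < s^2 / 384 \<le> Y\<close> requires, since it makes \<open>256 s^2\<close> smaller than \<open>1/384\<close>.
\<close>
lemma step_mean_cosh_powr_less:
  assumes s: "0 < s" "s \<le> 1/400" and q: "1 < q" "q \<le> 2"
  shows "step_mean s (\<lambda>z. cosh (2 * Re z)) powr q < step_mean s (\<lambda>z. cosh (2 * (sqrt q * Re z)))"
proof -
  have s2: "0 < s\<^sup>2" "s\<^sup>2 \<le> (1/400)\<^sup>2"
    using s by (auto intro: power_mono)
  then have s2': "0 \<le> 1 - s\<^sup>2"
    by (simp add: power_divide)
  define X where "X = step_mean s (\<lambda>z. cosh (2 * Re z)) - 1"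
  define Y where "Y = 2/3 * step_mean s (\<lambda>z. Re z ^ 4)"
  have X_eq: "X = (1 - s\<^sup>2) * (disc_mean s (\<lambda>z. cosh (2 * Re z)) - 1)
      + s\<^sup>2 * (disc_mean 1 (\<lambda>z. cosh (2 * Re z)) - 1)"
    by (simp add: X_def step_mean_def algebra_simps)
  have "0 \<le> X"
    unfolding X_eq using s s2'
    by (intro add_nonneg_nonneg mult_nonneg_nonneg) (auto simp: disc_mean_cosh_bounds)
  \<comment> \<open>The inner disk contributes little because it is small, the outer one because its mass is.\<close>
  have "X \<le> 1 * (8 * s\<^sup>2) + s\<^sup>2 * 8"
    unfolding X_eq
    using s s2' disc_mean_cosh_bounds[of s] disc_mean_cosh_bounds[of 1]
    by (intro add_mono mult_mono) auto
  then have "X\<^sup>2 \<le> (16 * s\<^sup>2)\<^sup>2"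
    using \<open>0 \<le> X\<close> by (intro power_mono) auto
  also have "\<dots> = s\<^sup>2 * (256 * s\<^sup>2)"
    by (simp add: power2_eq_square)
  also have "\<dots> < s\<^sup>2 * (1 / 384)"
    using s2 by (intro mult_strict_left_mono) (auto simp: power_divide)
  \<comment> \<open>The mass on the unit disk alone makes \<open>Y\<close> this large: \<open>(2/3) (1/256) = 1/384\<close>.\<close>
  also have "\<dots> \<le> Y"
  proof -
    have "disc_mean s (\<lambda>_. 0) \<le> disc_mean s (\<lambda>z. Re z ^ 4)"
      by (intro disc_mean_mono continuous_intros) auto
    then have "0 \<le> (1 - s\<^sup>2) * disc_mean s (\<lambda>z. Re z ^ 4)"
      using s2' s by (intro mult_nonneg_nonneg) (auto simp: disc_mean_const)
    moreover have "s\<^sup>2 * (1/256) \<le> s\<^sup>2 * disc_mean 1 (\<lambda>z. Re z ^ 4)"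
      by (intro mult_left_mono disc_mean_Re_power4_ge) auto
    ultimately show ?thesis
      by (simp add: Y_def step_mean_def)
  qed
  finally have "X\<^sup>2 < Y" .
  have "(1 + X) powr q \<le> (1 + X) * (1 + (q - 1) * X)"
    using \<open>0 \<le> X\<close> q by (intro one_plus_powr_le) auto
  also have "\<dots> = 1 + q * X + (q - 1) * X\<^sup>2"
    by (simp add: power2_eq_square algebra_simps)
  also have "\<dots> < 1 + q * X + (q - 1) * Y"
    using \<open>X\<^sup>2 < Y\<close> q by simp
  also have "\<dots> = (1 - s\<^sup>2) * (1 + q * (disc_mean s (\<lambda>z. cosh (2 * Re z)) - 1)
          + (q - 1) * (2/3 * disc_mean s (\<lambda>z. Re z ^ 4)))
      + s\<^sup>2 * (1 + q * (disc_mean 1 (\<lambda>z. cosh (2 * Re z)) - 1)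
          + (q - 1) * (2/3 * disc_mean 1 (\<lambda>z. Re z ^ 4)))"
    unfolding X_eq Y_def step_mean_def by algebra
  also have "\<dots> \<le> step_mean s (\<lambda>z. cosh (2 * (sqrt q * Re z)))"
    unfolding step_mean_def
    using s s2' q by (intro add_mono mult_left_mono disc_mean_cosh_sqrt_ge) auto
  finally show ?thesis
    by (simp add: X_def)
qed

theorem theorem1p3:
  shows "\<exists>(w :: real \<Rightarrow> real) (\<epsilon> :: real).
           bergman_weight w \<and> antimono_on {0..<1} w \<and> 0 < \<epsilon> \<and>
           (\<forall>q :: real. q = 2 \<or> q \<in> {1<..<1 + \<epsilon>} \<longrightarrow>
              \<not> bergman_norm (2 * q) w (dilation (1 / sqrt q) exp) \<le> bergman_norm 2 w exp)"
proof -
  define s :: real where "s = 1/400"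
  have s: "0 < s" "s < 1" "s \<le> 1/400"
    by (auto simp: s_def)
  have "bergman_norm 2 (step_weight s) exp
      < bergman_norm (2 * q) (step_weight s) (dilation (1 / sqrt q) exp)"
    if q: "1 < q" "q \<le> 2" for q
  proof -
    define E where "E = step_mean s (\<lambda>z. cosh (2 * Re z))"
    have "dilation 1 exp = exp"
      by (simp add: dilation_def fun_eq_iff)
    then have "bergman_norm 2 (step_weight s) exp = E powr (1 / 2)"
      using bergman_norm_dilated_exp[OF s(1,2), of 1] by (simp add: E_def)
    also have "\<dots> = (E powr q) powr (1 / (2 * q))"
      using q by (simp add: powr_powr)
    also have "\<dots> < step_mean s (\<lambda>z. cosh (2 * (sqrt q * Re z))) powr (1 / (2 * q))"
      unfolding E_def using q step_mean_cosh_powr_less[OF s(1,3) q]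
      by (intro powr_less_mono2) auto
    also have "\<dots> = bergman_norm (2 * q) (step_weight s) (dilation (1 / sqrt q) exp)"
      using q by (intro bergman_norm_dilated_exp[OF s(1,2), symmetric]) auto
    finally show ?thesis .
  qed
  note less = this
  have "\<forall>q. q = 2 \<or> q \<in> {1<..<1 + 1} \<longrightarrow>
      \<not> bergman_norm (2 * q) (step_weight s) (dilation (1 / sqrt q) exp)
        \<le> bergman_norm 2 (step_weight s) exp"
  proof (intro allI impI)
    fix q :: real assume "q = 2 \<or> q \<in> {1<..<1 + 1}"
    then have "1 < q" "q \<le> 2" by auto
    then show "\<not> bergman_norm (2 * q) (step_weight s) (dilation (1 / sqrt q) exp)
        \<le> bergman_norm 2 (step_weight s) exp"
      by (simp add: less not_le)
  qed
  moreover have "bergman_weight (step_weight s)" "antimono_on {0..<1} (step_weight s)"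
    using s by (auto intro: bergman_weight_step_weight antimono_step_weight)
  ultimately show ?thesis
    by (intro exI[of _ "step_weight s"] exI[of _ "1::real"]) auto
qed

end
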